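(* Let $n_x,n_y,S\geq 1$ be integers, let $\mathcal{K}_0\subseteq\mathbb{R}^{n_x}$ and $\mathcal{K}_i\subseteq\mathbb{R}^{n_y}$, $i=1,\dots,S$, be nonempty closed convex cones, and let $\mathsf{A}\in\mathcal{S}^{n_x}$, $\mathbf{a}\in\mathbb{R}^{n_x}$, $\mathsf{B}_i\in\mathbb{R}^{n_x\times n_y}$, $\mathsf{C}_i\in\mathcal{S}^{n_y}$, $\mathbf{c}_i,\mathbf{g}_i\in\mathbb{R}^{n_y}$ ($i=1,\dots,S$), $\mathbf{f}_i\in\mathbb{R}^{n_x}$, $d_i\in\mathbb{R}$ ($i=0,\dots,S$). Consider the quadratic problem $$(P)\quad \inf_{\mathbf{x},\mathbf{y}_1,\dots,\mathbf{y}_S}\Big\{\mathbf{x}^{\mathsf T}\mathsf{A}\mathbf{x}+\mathbf{a}^{\mathsf T}\mathbf{x}+\sum_{i=1}^S\big(\mathbf{x}^{\mathsf T}\mathsf{B}_i\mathbf{y}_i+\mathbf{y}_i^{\mathsf T}\mathsf{C}_i\mathbf{y}_i+\mathbf{c}_i^{\mathsf T}\mathbf{y}_i\big)\Big\}$$ subject to $\mathbf{f}_0^{\mathsf T}\mathbf{x}=d_0$, $\mathbf{x}\in\mathcal{K}_0$, and $\mathbf{f}_i^{\mathsf T}\mathbf{x}+\mathbf{g}_i^{\mathsf T}\mathbf{y}_i=d_i$, $\mathbf{y}_i\in\mathcal{K}_i$ for $i=1,\dots,S$. Consider also the conic problem $$(R)\quad \inf_{\mathsf{X},\mathbf{x},\mathsf{Y}_i,\mathsf{Z}_i,\mathbf{y}_i}\Big\{\mathsf{A}\bullet\mathsf{X}+\mathbf{a}^{\mathsf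 T}\mathbf{x}+\sum_{i=1}^S\big(\mathsf{B}_i^{\mathsf T}\bullet\mathsf{Z}_i+\mathsf{C}_i\bullet\mathsf{Y}_i+\mathbf{c}_i^{\mathsf T}\mathbf{y}_i\big)\Big\}$$ over $\mathsf{X}\in\mathcal{S}^{n_x}$, $\mathbf{x}\in\mathbb{R}^{n_x}$, $\mathsf{Y}_i\in\mathcal{S}^{n_y}$, $\mathsf{Z}_i\in\mathbb{R}^{n_y\times n_x}$, $\mathbf{y}_i\in\mathbb{R}^{n_y}$, subject to $\mathbf{f}_0^{\mathsf T}\mathbf{x}=d_0$, $\mathbf{f}_0\mathbf{f}_0^{\mathsf T}\bullet\mathsf{X}=d_0^2$, and, for $i=1,\dots,S$, $$\mathbf{f}_i^{\mathsf T}\mathbf{x}+\mathbf{g}_i^{\mathsf T}\mathbf{y}_i=d_i,\qquad \mathbf{f}_i\mathbf{f}_i^{\mathsf T}\bullet\mathsf{X}+2\,\mathbf{g}_i\mathbf{f}_i^{\mathsf T}\bullet\mathsf{Z}_i+\mathbf{g}_i\mathbf{g}_i^{\mathsf T}\bullet\mathsf{Y}_i=d_i^2,\qquad \begin{bmatrix}1&\mathbf{x}^{\mathsf T}&\mathbf{y}_i^{\mathsf T}\\ \mathbf{x}&\mathsf{X}&\mathsf{Z}_i^{\mathsf T}\\ \mathbf{y}_i&\mathsf{Z}_i&\mathsf{Y}_i\end{bmatrix}\in\mathcal{CPP}(\mathbb{R}_+\times\mathcal{K}_0\times\mathcal{K}_i).$$ Then the optimal value of $(R)$ is a lower bound on the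 optimal value of $(P)$. Assume in addition that $\mathbf{c}_i=\beta_i\mathbf{g}_i$ and $\mathsf{B}_i=\mathbf{b}_i\mathbf{g}_i^{\mathsf T}$ for some $\mathbf{b}_i\in\mathbb{R}^{n_x}$, $\beta_i\in\mathbb{R}$, $i=1,\dots,S$, and that, with $$\mathcal{F}_0=\{\mathbf{x}\in\mathcal{K}_0:\mathbf{f}_0^{\mathsf T}\mathbf{x}=d_0\},\qquad \mathcal{F}_i=\{[\mathbf{x}^{\mathsf T},\mathbf{y}_i^{\mathsf T}]^{\mathsf T}\in\mathcal{K}_0\times\mathcal{K}_i:\mathbf{f}_i^{\mathsf T}\mathbf{x}+\mathbf{g}_i^{\mathsf T}\mathbf{y}_i=d_i\},\ i=1,\dots,S,$$ $$\mathcal{X}_0=\left\{(\mathbf{x},\mathsf{X}):\begin{bmatrix}1&\mathbf{x}^{\mathsf T}\\ \mathbf{x}&\mathsf{X}\end{bmatrix}\in\mathcal{G}(\mathcal{F}_0)\right\},\qquad \mathcal{X}_i=\left\{(\mathbf{x},\mathsf{X}):\exists(\mathbf{y}_i,\mathsf{Y}_i,\mathsf{Z}_i):\begin{bmatrix}1&\mathbf{x}^{\mathsf T}&\mathbf{y}_i^{\mathsf T}\\ \mathbf{x}&\mathsf{X}&\mathsf{Z}_i^{\mathsf T}\\ \mathbf{y}_i&\mathsf{Z}_i&\mathsf{Y}_i\end{bmatrix}\in\mathcal{G}(\mathcal{F}_i)\right\},\ i=1,\dots,S,$$ the following hold: i. $\mathbf{g}_i\in\mathrm{int}(\mathcal{K}_i^*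 )$ for $i=1,\dots,S$; ii. the set $\mathcal{X}=\bigcap_{i=0}^S\mathcal{X}_i$ is bounded; iii. every extreme point of $\mathcal{X}$ is of the form $(\mathbf{x},\mathbf{x}\mathbf{x}^{\mathsf T})$. Then the bound is exact, i.e. the optimal values of $(P)$ and $(R)$ coincide.
   Context: $\mathcal{S}^k$ denotes the real symmetric $k\times k$ matrices; $\mathsf{A}\bullet\mathsf{B}=\mathrm{trace}(\mathsf{A}^{\mathsf T}\mathsf{B})$ for matrices of equal size. $\mathcal{K}^*=\{\mathbf{x}:\mathbf{y}^{\mathsf T}\mathbf{x}\geq0\ \forall\mathbf{y}\in\mathcal{K}\}$ is the dual cone. For a nonempty closed convex cone $\mathcal{K}\subseteq\mathbb{R}^k$, $\mathcal{CPP}(\mathcal{K})=\mathrm{conv}\{\mathbf{x}\mathbf{x}^{\mathsf T}:\mathbf{x}\in\mathcal{K}\}\subseteq\mathcal{S}^k$. For $\mathcal{F}\subseteq\mathbb{R}^k$, $\mathcal{G}(\mathcal{F})=\mathrm{cl}\,\mathrm{conv}\left\{\begin{bmatrix}1\\ \mathbf{x}\end{bmatrix}\begin{bmatrix}1\\ \mathbf{x}\end{bmatrix}^{\mathsf T}:\mathbf{x}\in\mathcal{F}\right\}\subseteq\mathcal{S}^{k+1}$. Optimal values are infima in $\mathbb{R}\cup\{\pm\infty\}$, with the infimum over the empty set equal to $+\infty$. *)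

theory Defs
  imports "HOL-Analysis.Analysis"
begin

section \<open>Matrices, block vectors and block matrices\<close>

text \<open>A real matrix with rows indexed by \<open>'m\<close> and columns by \<open>'n\<close> has type \<open>real^'n^'m\<close>.\<close>

definition sym_mats :: "(real^'n^'n) set" where
  "sym_mats = {A. transpose A = A}"

definition mat_inner :: "real^'n^'m \<Rightarrow> real^'n^'m \<Rightarrow> real" (infixl "\<bullet>\<^sub>M" 70) where
  "A \<bullet>\<^sub>M B = trace (transpose A ** B)"

definition outer :: "real^'m \<Rightarrow> real^'n \<Rightarrow> real^'n^'m" where
  "outer u v = (\<chi> i j. u $ i * v $ j)"

definition vcat :: "real^'a \<Rightarrow> real^'b \<Rightarrow> real^('a + 'b)" where
  "vcat u v = (\<chi> k. case k of Inl i \<Rightarrow> u $ i | Inr j \<Rightarrow> v $ j)"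

definition vprod :: "(real^'a) set \<Rightarrow> (real^'b) set \<Rightarrow> (real^('a + 'b)) set" where
  "vprod K L = {vcat u v | u v. u \<in> K \<and> v \<in> L}"

text \<open>The block matrix with block rows \<open>[A, B]\<close> and \<open>[C, D]\<close>.\<close>

definition block_mat ::
  "real^'c^'r \<Rightarrow> real^'d^'r \<Rightarrow> real^'c^'s \<Rightarrow> real^'d^'s \<Rightarrow> real^('c + 'd)^('r + 's)" where
  "block_mat A B C D =
     (\<chi> k. case k of Inl i \<Rightarrow> vcat (A $ i) (B $ i) | Inr j \<Rightarrow> vcat (C $ j) (D $ j))"

text \<open>\<open>[1, x\<^sup>T; x, X]\<close>; the index type \<open>1\<close> has exactly one element.\<close>

definition lift_mat :: "real^'k \<Rightarrow> real^'k^'k \<Rightarrow> real^(1 + 'k)^(1 + 'k)" where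
  "lift_mat x X = block_mat (mat 1) (rowvector x) (columnvector x) X"

text \<open>\<open>[1, x\<^sup>T, y\<^sup>T; x, X, Z\<^sup>T; y, Z, Y]\<close>, with the last two block rows and columns grouped.\<close>

definition lift_mat3 ::
  "real^'n \<Rightarrow> real^'n^'n \<Rightarrow> real^'m \<Rightarrow> real^'m^'m \<Rightarrow> real^'n^'m
     \<Rightarrow> real^(1 + ('n + 'm))^(1 + ('n + 'm))" where
  "lift_mat3 x X y Y Z = lift_mat (vcat x y) (block_mat X (transpose Z) Z Y)"


section \<open>Cones and lifted sets\<close>

definition closed_convex_cone :: "('a::euclidean_space) set \<Rightarrow> bool" where
  "closed_convex_cone K \<longleftrightarrow> closed K \<and> convex_cone K"

definition dual_cone :: "('a::real_inner) set \<Rightarrow> 'a set" where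
  "dual_cone K = {x. \<forall>y\<in>K. 0 \<le> y \<bullet> x}"

definition nonneg_line :: "(real^1) set" where
  "nonneg_line = {t. 0 \<le> t $ 1}"

definition CPP :: "(real^'k) set \<Rightarrow> (real^'k^'k) set" where
  "CPP K = convex hull ((\<lambda>x. outer x x) ` K)"

definition G_lift :: "(real^'k) set \<Rightarrow> (real^(1 + 'k)^(1 + 'k)) set" where
  "G_lift F = closure (convex hull ((\<lambda>x. outer (vcat (vec 1) x) (vcat (vec 1) x)) ` F))"


section \<open>The quadratic problem\<close>

text \<open>Families indexed by \<open>nat\<close> are only ever evaluated at indices up to \<open>S\<close>.\<close>

definition qp_feasible ::
  "nat \<Rightarrow> (real^'n) set \<Rightarrow> (nat \<Rightarrow> (real^'m) set) \<Rightarrow> (nat \<Rightarrow> real^'n) \<Rightarrow> (nat \<Rightarrow> real^'m)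
     \<Rightarrow> (nat \<Rightarrow> real) \<Rightarrow> ((real^'n) \<times> (nat \<Rightarrow> real^'m)) set" where
  "qp_feasible S K0 K f g d =
     {(x, y). f 0 \<bullet> x = d 0 \<and> x \<in> K0 \<and>
              (\<forall>i\<in>{1..S}. f i \<bullet> x + g i \<bullet> y i = d i \<and> y i \<in> K i)}"

definition qp_objective ::
  "nat \<Rightarrow> real^'n^'n \<Rightarrow> real^'n \<Rightarrow> (nat \<Rightarrow> real^'m^'n) \<Rightarrow> (nat \<Rightarrow> real^'m^'m) \<Rightarrow> (nat \<Rightarrow> real^'m)
     \<Rightarrow> real^'n \<Rightarrow> (nat \<Rightarrow> real^'m) \<Rightarrow> real" where
  "qp_objective S A a B C c x y =
     x \<bullet> (A *v x) + a \<bullet> x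
       + (\<Sum>i=1..S. x \<bullet> (B i *v y i) + y i \<bullet> (C i *v y i) + c i \<bullet> y i)"

definition qp_value ::
  "nat \<Rightarrow> (real^'n) set \<Rightarrow> (nat \<Rightarrow> (real^'m) set) \<Rightarrow> real^'n^'n \<Rightarrow> real^'n \<Rightarrow> (nat \<Rightarrow> real^'m^'n)
     \<Rightarrow> (nat \<Rightarrow> real^'m^'m) \<Rightarrow> (nat \<Rightarrow> real^'m) \<Rightarrow> (nat \<Rightarrow> real^'n) \<Rightarrow> (nat \<Rightarrow> real^'m)
     \<Rightarrow> (nat \<Rightarrow> real) \<Rightarrow> ereal" where
  "qp_value S K0 K A a B C c f g d =
     (INF (x, y) \<in> qp_feasible S K0 K f g d. ereal (qp_objective S A a B C c x y))"


section \<open>The conic problem\<close>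

definition cp_feasible ::
  "nat \<Rightarrow> (real^'n) set \<Rightarrow> (nat \<Rightarrow> (real^'m) set) \<Rightarrow> (nat \<Rightarrow> real^'n) \<Rightarrow> (nat \<Rightarrow> real^'m)
     \<Rightarrow> (nat \<Rightarrow> real)
     \<Rightarrow> ((real^'n^'n) \<times> (real^'n) \<times> (nat \<Rightarrow> real^'m^'m) \<times> (nat \<Rightarrow> real^'n^'m) \<times> (nat \<Rightarrow> real^'m)) set" where
  "cp_feasible S K0 K f g d =
     {(X, x, Y, Z, y).
        X \<in> sym_mats \<and> f 0 \<bullet> x = d 0 \<and> outer (f 0) (f 0) \<bullet>\<^sub>M X = (d 0)\<^sup>2 \<and>
        (\<forall>i\<in>{1..S}.
           Y i \<in> sym_mats \<and>
           f i \<bullet> x + g i \<bullet> y i = d i \<and>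
           outer (f i) (f i) \<bullet>\<^sub>M X + 2 * (outer (g i) (f i) \<bullet>\<^sub>M Z i)
             + outer (g i) (g i) \<bullet>\<^sub>M Y i = (d i)\<^sup>2 \<and>
           lift_mat3 x X (y i) (Y i) (Z i) \<in> CPP (vprod nonneg_line (vprod K0 (K i))))}"

definition cp_objective ::
  "nat \<Rightarrow> real^'n^'n \<Rightarrow> real^'n \<Rightarrow> (nat \<Rightarrow> real^'m^'n) \<Rightarrow> (nat \<Rightarrow> real^'m^'m) \<Rightarrow> (nat \<Rightarrow> real^'m)
     \<Rightarrow> real^'n^'n \<Rightarrow> real^'n \<Rightarrow> (nat \<Rightarrow> real^'m^'m) \<Rightarrow> (nat \<Rightarrow> real^'n^'m) \<Rightarrow> (nat \<Rightarrow> real^'m)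
     \<Rightarrow> real" where
  "cp_objective S A a B C c X x Y Z y =
     A \<bullet>\<^sub>M X + a \<bullet> x
       + (\<Sum>i=1..S. transpose (B i) \<bullet>\<^sub>M Z i + C i \<bullet>\<^sub>M Y i + c i \<bullet> y i)"

definition cp_value ::
  "nat \<Rightarrow> (real^'n) set \<Rightarrow> (nat \<Rightarrow> (real^'m) set) \<Rightarrow> real^'n^'n \<Rightarrow> real^'n \<Rightarrow> (nat \<Rightarrow> real^'m^'n)
     \<Rightarrow> (nat \<Rightarrow> real^'m^'m) \<Rightarrow> (nat \<Rightarrow> real^'m) \<Rightarrow> (nat \<Rightarrow> real^'n) \<Rightarrow> (nat \<Rightarrow> real^'m)
     \<Rightarrow> (nat \<Rightarrow> real) \<Rightarrow> ereal" where
  "cp_value S K0 K A a B C c f g d =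
     (INF (X, x, Y, Z, y) \<in> cp_feasible S K0 K f g d.
        ereal (cp_objective S A a B C c X x Y Z y))"


section \<open>The projected lifted feasible sets\<close>

definition feas0 :: "(real^'n) set \<Rightarrow> real^'n \<Rightarrow> real \<Rightarrow> (real^'n) set" where
  "feas0 K0 f0 d0 = {x \<in> K0. f0 \<bullet> x = d0}"

definition feas ::
  "(real^'n) set \<Rightarrow> (real^'m) set \<Rightarrow> real^'n \<Rightarrow> real^'m \<Rightarrow> real \<Rightarrow> (real^('n + 'm)) set" where
  "feas K0 Ki fi gi di = {vcat x y | x y. x \<in> K0 \<and> y \<in> Ki \<and> fi \<bullet> x + gi \<bullet> y = di}"

definition X0_set :: "(real^'n) set \<Rightarrow> real^'n \<Rightarrow> real \<Rightarrow> ((real^'n) \<times> (real^'n^'n)) set" where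
  "X0_set K0 f0 d0 = {(x, X). lift_mat x X \<in> G_lift (feas0 K0 f0 d0)}"

definition Xi_set ::
  "(real^'n) set \<Rightarrow> (real^'m) set \<Rightarrow> real^'n \<Rightarrow> real^'m \<Rightarrow> real \<Rightarrow> ((real^'n) \<times> (real^'n^'n)) set" where
  "Xi_set K0 Ki fi gi di =
     {(x, X). \<exists>y Y Z. lift_mat3 x X y Y Z \<in> G_lift (feas K0 Ki fi gi di)}"

definition X_set ::
  "nat \<Rightarrow> (real^'n) set \<Rightarrow> (nat \<Rightarrow> (real^'m) set) \<Rightarrow> (nat \<Rightarrow> real^'n) \<Rightarrow> (nat \<Rightarrow> real^'m)
     \<Rightarrow> (nat \<Rightarrow> real) \<Rightarrow> ((real^'n) \<times> (real^'n^'n)) set" where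
  "X_set S K0 K f g d =
     X0_set K0 (f 0) (d 0) \<inter> (\<Inter>i\<in>{1..S}. Xi_set K0 (K i) (f i) (g i) (d i))"

end

theory Submission
  imports Defs
begin

text \<open>
  A feasible point \<open>(x, y)\<close> of the quadratic problem gives the feasible point of the conic problem
  whose block matrices are \<open>z z\<^sup>T\<close> with \<open>z = (1, x, y\<^sub>i)\<close>, with the same objective value; hence the
  conic value is a lower bound.

  For the converse, a feasible point of the conic problem is first shown to lie in the lifted
  sets: \<open>d\<^sup>2 - 2 d (h \<bullet> w) + h\<^sup>T W h = 0\<close> forces every term \<open>(t, w)(t, w)\<^sup>T\<close> of a completely positive
  decomposition to satisfy \<open>h \<bullet> w = d t\<close>, so terms with \<open>t > 0\<close> rescale to feasible points and terms
  with \<open>t = 0\<close> are recession directions of the feasible set (\<open>CPP_imp_G_lift\<close>).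
  In particular \<open>(x, X)\<close> lies in the intersection of the projected lifted sets.

  Because \<open>g\<^sub>i\<close> is interior to the dual cone, the slice \<open>{y \<in> K\<^sub>i. g\<^sub>i \<bullet> y = 1}\<close> is compact. If it is
  nonempty, \<open>y\<^sup>T C\<^sub>i y\<close> attains its minimum \<open>q\<^sub>i\<close> on it, and homogeneity gives
  \<open>y\<^sup>T C\<^sub>i y \<ge> q\<^sub>i (g\<^sub>i \<bullet> y)\<^sup>2\<close> on the whole cone; otherwise the cone is trivial
  (\<open>quadratic_minimizer_on_cone\<close>).
  As the other terms see \<open>y\<^sub>i\<close> only through \<open>g\<^sub>i \<bullet> y\<^sub>i = d\<^sub>i - f\<^sub>i \<bullet> x\<close>, each summand of the conic
  objective is bounded below by an affine function of \<open>(x, X)\<close> alone (\<open>scenario_lower_bound\<close>).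

  The same interiority makes the projected lifted sets closed (\<open>closed_Xi_set\<close>), so their bounded
  intersection is compact and convex, and by the theorem of Krein, Milman and Minkowski the affine
  bound is no larger at some extreme point, which has the form \<open>(\<xi>, \<xi> \<xi>\<^sup>T)\<close>.
  There the bound is attained by the quadratic problem, at \<open>\<xi>\<close> together with the multiples
  \<open>(d\<^sub>i - f\<^sub>i \<bullet> \<xi>) y\<^sub>0\<close> of the minimizers.
\<close>

section \<open>Block algebra\<close>

lemma sum_UNIV_Plus:
  fixes h :: "'a::finite + 'b::finite \<Rightarrow> 'c::comm_monoid_add"
  shows "(\<Sum>k\<in>UNIV. h k) = (\<Sum>i\<in>UNIV. h (Inl i)) + (\<Sum>j\<in>UNIV. h (Inr j))"
  by (simp add: UNIV_Plus_UNIV [symmetric] sum.Plus del: UNIV_Plus_UNIV)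

lemma vcat_nth [simp]: "vcat u v $ Inl i = u $ i" "vcat u v $ Inr j = v $ j"
  by (simp_all add: vcat_def)

lemma block_mat_nth [simp]:
  "block_mat A B C D $ Inl i = vcat (A $ i) (B $ i)"
  "block_mat A B C D $ Inr j = vcat (C $ j) (D $ j)"
  by (simp_all add: block_mat_def)

lemma outer_nth [simp]: "outer u v $ i $ j = u $ i * v $ j"
  by (simp add: outer_def)

lemma all_Plus_iff: "(\<forall>k::'a + 'b. P k) \<longleftrightarrow> (\<forall>i. P (Inl i)) \<and> (\<forall>j. P (Inr j))"
  by (metis sum.exhaust)

lemma vcat_eq_iff [simp]: "vcat u v = vcat u' v' \<longleftrightarrow> u = u' \<and> v = v'"
  by (auto simp: vec_eq_iff all_Plus_iff)

lemma block_mat_eq_iff [simp]: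
  "block_mat A B C D = block_mat A' B' C' D' \<longleftrightarrow> A = A' \<and> B = B' \<and> C = C' \<and> D = D'"
  by (auto simp: vec_eq_iff all_Plus_iff)

lemma vcat_add: "vcat u v + vcat u' v' = vcat (u + u') (v + v')"
  by (simp add: vec_eq_iff all_Plus_iff)

lemma vcat_scaleR: "s *\<^sub>R vcat u v = vcat (s *\<^sub>R u) (s *\<^sub>R v)"
  by (simp add: vec_eq_iff all_Plus_iff)

lemma outer_scaleR: "outer (s *\<^sub>R u) (t *\<^sub>R v) = (s * t) *\<^sub>R outer u v"
  by (simp add: vec_eq_iff)

lemma inner_vcat: "vcat u v \<bullet> vcat u' v' = u \<bullet> u' + v \<bullet> v'"
  by (simp add: inner_vec_def sum_UNIV_Plus)

lemma inner_block_mat: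
  "block_mat A B C D \<bullet> block_mat A' B' C' D' = A \<bullet> A' + B \<bullet> B' + C \<bullet> C' + D \<bullet> D'"
  by (simp add: inner_vec_def [of "block_mat A B C D"] sum_UNIV_Plus inner_vcat sum.distrib
      inner_vec_def [of A] inner_vec_def [of B] inner_vec_def [of C] inner_vec_def [of D])

lemma inner_outer: "Q \<bullet> outer u v = u \<bullet> (Q *v v)"
  by (simp add: inner_vec_def matrix_vector_mult_def sum_distrib_left mult_ac)

lemma outer_mult_vec: "outer a b *v v = (b \<bullet> v) *\<^sub>R a"
  by (simp add: vec_eq_iff matrix_vector_mult_def inner_vec_def sum_distrib_left sum_distrib_right
      mult_ac)

lemma outer_inner_outer: "outer a b \<bullet> outer u v = (a \<bullet> u) * (b \<bullet> v)"
  by (simp add: inner_outer outer_mult_vec inner_commute)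

lemma mat_inner_eq_inner: "A \<bullet>\<^sub>M B = A \<bullet> B"
  unfolding mat_inner_def trace_def transpose_def matrix_matrix_mult_def inner_vec_def
  by (simp add: sum.swap [of "\<lambda>i j. A $ i $ j * B $ i $ j"])

lemma inner_transpose:
  fixes A B :: "real^'n^'m"
  shows "transpose A \<bullet> transpose B = A \<bullet> B"
  unfolding transpose_def inner_vec_def
  by (simp add: sum.swap [of "\<lambda>i j. A $ i $ j * B $ i $ j"])

lemma transpose_outer [simp]: "transpose (outer u v) = outer v u"
  by (simp add: vec_eq_iff transpose_def)

lemma mat_1_inner_outer: "mat 1 \<bullet> outer u v = u \<bullet> v"
  by (simp add: inner_outer)

lemma norm_outer_self: "norm (outer u u) = mat 1 \<bullet> outer u u"
  by (simp add: norm_eq_sqrt_inner [of "outer u u"] outer_inner_outer mat_1_inner_outer)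

lemma outer_vcat:
  "outer (vcat u v) (vcat u' v') = block_mat (outer u u') (outer u v') (outer v u') (outer v v')"
  by (simp add: vec_eq_iff all_Plus_iff)

lemma lift_mat_outer [simp]: "outer (vcat 1 w) (vcat 1 w) = lift_mat w (outer w w)"
  by (simp add: lift_mat_def outer_vcat)
    (simp add: vec_eq_iff rowvector_def columnvector_def mat_def num1_eq_iff)

lemma lift_mat3_outer:
  "lift_mat3 x (outer x x) y (outer y y) (outer y x) = lift_mat (vcat x y) (outer (vcat x y) (vcat x y))"
  by (simp add: lift_mat3_def outer_vcat)

text \<open>Pairing a lifted matrix with \<open>[\<alpha>, h\<^sup>T; 0, Q]\<close>; every quadratic polynomial \<open>\<alpha> + h\<^sup>T w + w\<^sup>T Q w\<close>
  thereby becomes a linear functional of the lifting.\<close>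

lemma inner_lift_mat:
  "block_mat (mat \<alpha>) (rowvector h) 0 Q \<bullet> lift_mat w W = \<alpha> + h \<bullet> w + Q \<bullet> W"
  by (simp add: lift_mat_def inner_block_mat)
    (simp add: inner_vec_def rowvector_def columnvector_def mat_def sum_1)


section \<open>Blocks of lifted matrices\<close>

text \<open>The blocks \<open>w\<close> and \<open>W\<close> of a matrix \<open>[1, w\<^sup>T; w, W]\<close>; \<open>w\<close> is read off the first column.\<close>

definition wpart :: "real^(1 + 'k)^(1 + 'k) \<Rightarrow> real^'k" where
  "wpart M = (\<chi> i. M $ Inr i $ Inl 1)"

definition Wpart :: "real^(1 + 'k)^(1 + 'k) \<Rightarrow> real^'k^'k" where
  "Wpart M = (\<chi> i j. M $ Inr i $ Inr j)"

lemma wpart_lift_mat [simp]: "wpart (lift_mat w W) = w"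
  by (simp add: wpart_def lift_mat_def columnvector_def vec_eq_iff)

lemma Wpart_lift_mat [simp]: "Wpart (lift_mat w W) = W"
  by (simp add: Wpart_def lift_mat_def vec_eq_iff)

lemma linear_wpart: "linear wpart"
  by (rule linearI) (simp_all add: wpart_def vec_eq_iff)


section \<open>Properties of the lifting\<close>

lemma convex_G_lift: "convex (G_lift F)"
  by (simp add: G_lift_def)

lemma closed_G_lift: "closed (G_lift F)"
  by (simp add: G_lift_def)

lemma G_lift_generator:
  "w \<in> F \<Longrightarrow> lift_mat w (outer w w) \<in> G_lift F"
  unfolding G_lift_def by (rule subsetD [OF closure_subset], rule hull_inc) auto

lemma G_lift_subset:
  assumes "closed T" "convex T"
    and "\<And>w. w \<in> F \<Longrightarrow> lift_mat w (outer w w) \<in> T"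
  shows "G_lift F \<subseteq> T"
  unfolding G_lift_def using assms by (intro closure_minimal hull_minimal) auto

text \<open>Elements of the lifting are symmetric with upper left entry \<open>1\<close>.\<close>

lemma G_lift_entries:
  assumes "M \<in> G_lift F"
  shows "M $ Inl 1 $ Inl 1 = 1" and "M $ k $ l = M $ l $ k"
proof -
  have "G_lift F \<subseteq> {M. M $ Inl 1 $ Inl 1 = 1}"
    by (intro G_lift_subset closed_Collect_eq continuous_intros)
      (auto simp: convex_def algebra_simps lift_mat_def mat_def)
  moreover have "G_lift F \<subseteq> {M. M $ k $ l = M $ l $ k}"
    by (intro G_lift_subset closed_Collect_eq continuous_intros)
      (auto simp: convex_def mult_ac simp flip: lift_mat_outer)
  ultimately show "M $ Inl 1 $ Inl 1 = 1" "M $ k $ l = M $ l $ k"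
    using assms by blast+
qed

lemma G_lift_eq_lift_mat:
  assumes "M \<in> G_lift F"
  shows "M = lift_mat (wpart M) (Wpart M)"
  using G_lift_entries [OF assms]
  by (simp add: vec_eq_iff all_Plus_iff lift_mat_def wpart_def Wpart_def rowvector_def
      columnvector_def mat_def num1_eq_iff)

lemma G_lift_eq_lift_mat3:
  assumes "M \<in> G_lift F"
  shows "\<exists>x X y Y Z. M = lift_mat3 x X y Y Z"
proof -
  let ?w = "wpart M" and ?W = "Wpart M"
  have sym: "?W $ k $ l = ?W $ l $ k" for k l
    using G_lift_entries(2) [OF assms] by (simp add: Wpart_def)
  have "?w = vcat (\<chi> i. ?w $ Inl i) (\<chi> j. ?w $ Inr j)"
    by (simp add: vec_eq_iff all_Plus_iff)
  moreover define Z where "Z = (\<chi> j i. ?W $ Inr j $ Inl i)"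
  have "?W = block_mat (\<chi> i i'. ?W $ Inl i $ Inl i') (transpose Z) Z (\<chi> j j'. ?W $ Inr j $ Inr j')"
    using sym by (simp add: vec_eq_iff all_Plus_iff transpose_def Z_def)
  ultimately show ?thesis
    using G_lift_eq_lift_mat [OF assms] unfolding lift_mat3_def by metis
qed

lemma wpart_in_feasible_set:
  assumes "M \<in> G_lift F" "closed F" "convex F"
  shows "wpart M \<in> F"
proof -
  have "G_lift F \<subseteq> wpart -` F"
  proof (rule G_lift_subset)
    show "closed (wpart -` F)"
      using assms(2) linear_continuous_on [of wpart UNIV] linear_wpart
      by (intro closed_vimage) (simp_all add: linear_conv_bounded_linear)
    show "convex (wpart -` F)"
      using assms(3) by (intro convex_linear_vimage linear_wpart)
  qed simp
  then show ?thesis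
    using assms(1) by auto
qed

text \<open>A quadratic inequality valid on \<open>F\<close> linearizes to one valid on the lifting of \<open>F\<close>.\<close>

lemma quadratic_inequality_lifts:
  assumes "lift_mat w W \<in> G_lift F"
    and "\<And>v. v \<in> F \<Longrightarrow> 0 \<le> \<alpha> + h \<bullet> v + v \<bullet> (Q *v v)"
  shows "0 \<le> \<alpha> + h \<bullet> w + Q \<bullet> W"
proof -
  let ?R = "block_mat (mat \<alpha>) (rowvector h) 0 Q"
  have "G_lift F \<subseteq> {M. ?R \<bullet> M \<ge> 0}"
    using assms(2)
    by (intro G_lift_subset closed_halfspace_ge convex_halfspace_ge)
      (simp add: inner_lift_mat inner_outer [of Q])
  then show ?thesis
    using assms(1) by (auto simp: inner_lift_mat)
qed

text \<open>The lifting consists of positive semidefinite matrices, so the trace dominates the norm.\<close>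

lemma norm_G_lift_le:
  fixes w :: "real^'k"
  assumes "lift_mat w W \<in> G_lift F"
  shows "norm (lift_mat w W) \<le> 1 + mat 1 \<bullet> W"
proof -
  have "convex {M::real^(1+'k)^(1+'k). norm M \<le> mat 1 \<bullet> M}"
  proof (rule convexI, clarify)
    fix M N :: "real^(1+'k)^(1+'k)" and u v :: real
    assume *: "norm M \<le> mat 1 \<bullet> M" "norm N \<le> mat 1 \<bullet> N" "0 \<le> u" "0 \<le> v"
    have "norm (u *\<^sub>R M + v *\<^sub>R N) \<le> u * norm M + v * norm N"
      using norm_triangle_ineq [of "u *\<^sub>R M" "v *\<^sub>R N"] * by simp
    also have "\<dots> \<le> u * (mat 1 \<bullet> M) + v * (mat 1 \<bullet> N)"
      using * by (intro add_mono mult_left_mono)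
    finally show "norm (u *\<^sub>R M + v *\<^sub>R N) \<le> mat 1 \<bullet> (u *\<^sub>R M + v *\<^sub>R N)"
      by (simp add: inner_add_right)
  qed
  then have "G_lift F \<subseteq> {M. norm M \<le> mat 1 \<bullet> M}"
    by (intro G_lift_subset closed_Collect_le continuous_intros)
      (simp_all add: norm_outer_self flip: lift_mat_outer)
  then have "norm (lift_mat w W) \<le> mat 1 \<bullet> lift_mat w W"
    using assms by blast
  also have "(mat 1 :: real^(1 + 'k)^(1 + 'k)) = block_mat (mat 1) (rowvector 0) 0 (mat 1)"
    by (auto simp: vec_eq_iff all_Plus_iff mat_def rowvector_def num1_eq_iff)
  also have "\<dots> \<bullet> lift_mat w W = 1 + mat 1 \<bullet> W"
    using inner_lift_mat [of 1 0 "mat 1" w W] by simp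
  finally show ?thesis .
qed

text \<open>A linear image of a closed set is closed when the norm of a point is bounded by a continuous
  function of its image: preimages of convergent sequences are then bounded.\<close>

lemma closed_image_of_controlled_norm:
  fixes p :: "'a::euclidean_space \<Rightarrow> 'b::real_normed_vector" and h :: "'b \<Rightarrow> real"
  assumes "closed G" and p: "linear p" and h: "continuous_on UNIV h"
    and le: "\<And>M. M \<in> G \<Longrightarrow> norm M \<le> h (p M)"
  shows "closed (p ` G)"
  unfolding closed_sequential_limits
proof (intro allI impI, elim conjE)
  fix q l
  assume q: "\<forall>n. q n \<in> p ` G" and l: "q \<longlonglongrightarrow> l"
  have "\<forall>n. \<exists>m. m \<in> G \<and> q n = p m"
    using q by blast
  then obtain M where M: "\<And>n. M n \<in> G" "\<And>n. q n = p (M n)"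
    using choice [of "\<lambda>n m. m \<in> G \<and> q n = p m"] by blast
  have "(\<lambda>n. h (q n)) \<longlonglongrightarrow> h l"
    using h l by (intro isCont_tendsto_compose [of l h]) (simp_all add: continuous_on_eq_continuous_at)
  then have "Bseq (\<lambda>n. h (q n))"
    by (intro convergent_imp_Bseq convergentI)
  then obtain c where "\<And>n. norm (h (q n)) \<le> c"
    unfolding Bseq_def by blast
  then have "norm (M n) \<le> c" for n
    using le [OF M(1) [of n]] M(2) [of n] by (metis abs_le_D1 order_trans real_norm_def)
  then have "bounded (range M)"
    by (auto intro: boundedI)
  then obtain L r where r: "strict_mono r" "(M \<circ> r) \<longlonglongrightarrow> L"
    using bounded_imp_convergent_subsequence by blast
  then have "L \<in> G"
    using \<open>closed G\<close> M(1) by (metis closed_sequentially comp_apply)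
  have "(\<lambda>n. p ((M \<circ> r) n)) \<longlonglongrightarrow> p L"
    using p r(2) unfolding linear_conv_bounded_linear by (rule bounded_linear.tendsto)
  then have "(q \<circ> r) \<longlonglongrightarrow> p L"
    by (simp add: o_def M(2))
  then have "l = p L"
    using LIMSEQ_subseq_LIMSEQ [OF l r(1)] LIMSEQ_unique by blast
  then show "l \<in> p ` G"
    using \<open>L \<in> G\<close> by blast
qed

section \<open>From the completely positive cone to the lifting\<close>

text \<open>A linear functional that is nonnegative on \<open>S\<close> vanishes at a point of the hull only if that point
  is a combination of zeros of the functional in \<open>S\<close>.\<close>

lemma convex_hull_null_face:
  fixes S :: "'a::euclidean_space set"
  assumes nonneg: "\<And>s. s \<in> S \<Longrightarrow> 0 \<le> v \<bullet> s"
    and "x \<in> convex hull S" "v \<bullet> x = 0"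
  shows "x \<in> convex hull {s \<in> S. v \<bullet> s = 0}"
proof -
  let ?H = "convex hull {s \<in> S. v \<bullet> s = 0}"
  have "convex {x. 0 \<le> v \<bullet> x \<and> (v \<bullet> x = 0 \<longrightarrow> x \<in> ?H)}"
  proof (rule convexI, clarify)
    fix x y and a b :: real
    assume x: "0 \<le> v \<bullet> x" "v \<bullet> x = 0 \<longrightarrow> x \<in> ?H"
      and y: "0 \<le> v \<bullet> y" "v \<bullet> y = 0 \<longrightarrow> y \<in> ?H"
      and ab: "0 \<le> a" "0 \<le> b" "a + b = 1"
    have *: "0 \<le> a * (v \<bullet> x)" "0 \<le> b * (v \<bullet> y)"
      using x y ab by simp_all
    have "a *\<^sub>R x + b *\<^sub>R y \<in> ?H" if "a * (v \<bullet> x) + b * (v \<bullet> y) = 0"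
    proof (cases "a = 0 \<or> b = 0")
      case True
      then show ?thesis
        using that x y ab by auto
    next
      case False
      then have "v \<bullet> x = 0" "v \<bullet> y = 0"
        using that * by (simp_all add: add_nonneg_eq_0_iff)
      then show ?thesis
        using x y ab by (intro convexD convex_convex_hull) auto
    qed
    then show "0 \<le> v \<bullet> (a *\<^sub>R x + b *\<^sub>R y)
        \<and> (v \<bullet> (a *\<^sub>R x + b *\<^sub>R y) = 0 \<longrightarrow> a *\<^sub>R x + b *\<^sub>R y \<in> ?H)"
      using * by (simp add: inner_add_right)
  qed
  then have "convex hull S \<subseteq> {x. 0 \<le> v \<bullet> x \<and> (v \<bullet> x = 0 \<longrightarrow> x \<in> ?H)}"
    using nonneg by (intro hull_minimal) (auto intro: hull_inc)
  then show ?thesis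
    using assms by auto
qed

text \<open>A quadratic function bounded below on a half-line has nonnegative leading coefficient.\<close>

lemma leading_coefficient_nonneg:
  fixes \<alpha> \<beta> \<gamma> \<kappa> :: real
  assumes "\<And>s. 0 \<le> s \<Longrightarrow> \<beta> \<le> \<alpha> + \<kappa> * s + \<gamma> * s\<^sup>2"
  shows "0 \<le> \<gamma>"
proof (rule ccontr)
  assume "\<not> 0 \<le> \<gamma>"
  then have neg: "\<gamma> < 0" by simp
  define c where "c = \<bar>\<kappa>\<bar> + \<bar>\<alpha> - \<beta>\<bar>"
  define s where "s = 1 + c / (- \<gamma>)"
  have s: "1 \<le> s"
    using neg by (simp add: s_def c_def divide_nonneg_neg)
  have "\<kappa> * s \<le> \<bar>\<kappa>\<bar> * s"
    using s by (intro mult_right_mono) auto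
  moreover have "\<alpha> - \<beta> \<le> \<bar>\<alpha> - \<beta>\<bar> * s"
    using s mult_left_mono [of 1 s "\<bar>\<alpha> - \<beta>\<bar>"] by simp
  moreover have "\<gamma> * s\<^sup>2 + c * s = \<gamma> * s"
    using neg by (simp add: s_def field_simps power2_eq_square)
  moreover have "\<gamma> * s < 0"
    using neg s by (simp add: mult_neg_pos)
  ultimately have "\<alpha> + \<kappa> * s + \<gamma> * s\<^sup>2 < \<beta>"
    by (simp add: c_def algebra_simps)
  then show False
    using assms [of s] s by simp
qed

text \<open>The two moment equations \<open>h \<bullet> w = d\<close> and \<open>h\<^sup>T W h = d\<^sup>2\<close> reduce a completely positive matrix to the
  lifting of the slice of the cone. A matrix outside the lifting is strictly separated from it by
  \<open>Q\<close> and \<open>\<beta>\<close>, and the form \<open>z\<^sup>T Q z - \<beta> t\<^sup>2\<close> with \<open>z = (t, u)\<close> turns out to be nonnegative on all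
  generators that can occur.\<close>

lemma CPP_imp_G_lift:
  fixes w h :: "real^'k"
  assumes C: "convex_cone C"
    and M: "lift_mat w W \<in> CPP (vprod nonneg_line C)"
    and lin: "h \<bullet> w = d" and quad: "outer h h \<bullet> W = d\<^sup>2"
  shows "lift_mat w W \<in> G_lift {v \<in> C. h \<bullet> v = d}"
proof (rule ccontr)
  let ?F = "{v \<in> C. h \<bullet> v = d}" and ?M = "lift_mat w W"
  let ?sq = "\<lambda>z::real^(1 + 'k). outer z z"
  \<comment> \<open>\<open>?r \<bullet> z = 0\<close> is the homogenized constraint \<open>h \<bullet> u = d t\<close>.\<close>
  let ?r = "vcat (vec (- d)) h"
  define L where "L = {z \<in> vprod nonneg_line C. ?r \<bullet> z = 0}"
  assume notin: "?M \<notin> G_lift ?F"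
  then obtain Q \<beta> where sep: "Q \<bullet> ?M < \<beta>" "\<And>N. N \<in> G_lift ?F \<Longrightarrow> \<beta> < Q \<bullet> N"
    using separating_hyperplane_closed_point [OF convex_G_lift closed_G_lift notin] by blast
  have r: "outer ?r ?r \<bullet> ?sq z = (?r \<bullet> z)\<^sup>2" for z
    by (simp add: outer_inner_outer power2_eq_square)
  have "outer ?r ?r \<bullet> ?M = 0"
  proof -
    have "outer ?r ?r \<bullet> ?M = d\<^sup>2 - 2 * d * (h \<bullet> w) + outer h h \<bullet> W"
      by (simp add: lift_mat_def outer_vcat inner_block_mat)
        (simp add: inner_vec_def rowvector_def columnvector_def mat_def sum_1 sum_distrib_left
          power2_eq_square sum_negf mult_ac)
    then show ?thesis
      by (simp add: lin quad power2_eq_square)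
  qed
  then have "?M \<in> convex hull {N \<in> ?sq ` vprod nonneg_line C. outer ?r ?r \<bullet> N = 0}"
    using M unfolding CPP_def by (intro convex_hull_null_face) (auto simp: r)
  moreover have "{N \<in> ?sq ` vprod nonneg_line C. outer ?r ?r \<bullet> N = 0} = ?sq ` L"
    by (auto simp: L_def r)
  ultimately have MconvL: "?M \<in> convex hull (?sq ` L)"
    by simp
  \<comment> \<open>\<open>E\<close> extracts the upper left entry.\<close>
  define E :: "real^(1 + 'k)^(1 + 'k)" where "E = block_mat (mat 1) (rowvector 0) 0 0"
  have E: "E \<bullet> ?M = 1"
    by (simp add: E_def inner_lift_mat)
  have E_sq: "E \<bullet> ?sq (vcat t u) = (t $ 1)\<^sup>2" for t u
    by (simp add: E_def outer_vcat inner_block_mat)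
      (simp add: inner_vec_def rowvector_def mat_def sum_1 power2_eq_square)
  have LE: "\<exists>t u. z = vcat (vec t) u \<and> 0 \<le> t \<and> u \<in> C \<and> h \<bullet> u = d * t" if "z \<in> L" for z
  proof -
    obtain t u where z: "z = vcat t u" "0 \<le> t $ 1" "u \<in> C" "?r \<bullet> z = 0"
      using \<open>z \<in> L\<close> unfolding L_def vprod_def nonneg_line_def by blast
    have "t = vec (t $ 1)"
      unfolding vec_eq_iff forall_1 by simp
    moreover have "h \<bullet> u = d * t $ 1"
      using z by (simp add: inner_vcat) (simp add: inner_vec_def sum_1)
    moreover have "z = vcat (vec (t $ 1)) u"
      unfolding z(1) by (rule arg_cong [where f = "\<lambda>s. vcat s u"]) fact
    ultimately show ?thesis
      using z(2,3) by blast
  qed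
  have pos: "t \<noteq> 0 \<Longrightarrow> (1 / t) *\<^sub>R u \<in> ?F"
    if "0 \<le> t" "u \<in> C" "h \<bullet> u = d * t" for t :: real and u
    using that convex_cone_scaleR [OF C, of "1/t" u] by auto
  \<comment> \<open>If the slice were empty, all generators would have \<open>t = 0\<close>, and so would the upper left entry.\<close>
  obtain w0 where w0: "w0 \<in> ?F"
  proof (rule ccontr)
    assume "\<not> thesis"
    then have none: "?F = {}"
      using that by blast
    have "?sq ` L \<subseteq> {N. E \<bullet> N \<le> 0}"
    proof clarify
      fix z
      assume "z \<in> L"
      then obtain t u where z: "z = vcat (vec t) u" "0 \<le> t" "u \<in> C" "h \<bullet> u = d * t"
        using LE by blast
      then have "t = 0"
        using pos none by blast
      then show "E \<bullet> ?sq z \<le> 0"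
        by (simp add: z(1) E_sq)
    qed
    then have "convex hull (?sq ` L) \<subseteq> {N. E \<bullet> N \<le> 0}"
      by (intro hull_minimal convex_halfspace_le)
    then show False
      using MconvL E by auto
  qed
  have "?sq ` L \<subseteq> {N. 0 \<le> (Q - \<beta> *\<^sub>R E) \<bullet> N}"
  proof clarify
    fix z
    assume "z \<in> L"
    then obtain t u where z: "z = vcat (vec t) u" "0 \<le> t" "u \<in> C" "h \<bullet> u = d * t"
      using LE by blast
    show "0 \<le> (Q - \<beta> *\<^sub>R E) \<bullet> ?sq z"
    proof (cases "t = 0")
      case True
      \<comment> \<open>Here \<open>u\<close> is a recession direction, and the form is bounded below along a ray.\<close>
      let ?e = "vcat (vec 1) w0"
      have "\<beta> \<le> Q \<bullet> ?sq ?e + (Q \<bullet> outer ?e z + Q \<bullet> outer z ?e) * s + (Q \<bullet> ?sq z) * s\<^sup>2"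
        if "0 \<le> s" for s
      proof -
        have "w0 + s *\<^sub>R u \<in> ?F"
          using w0 z True that C
          by (simp add: inner_add_right convex_cone_add convex_cone_scaleR)
        moreover have "vcat (vec 1) (w0 + s *\<^sub>R u) = ?e + s *\<^sub>R z"
          using True by (simp add: z(1) vcat_add vcat_scaleR vec_eq_iff)
        ultimately have "\<beta> < Q \<bullet> ?sq (?e + s *\<^sub>R z)"
          using sep(2) [OF G_lift_generator, of "w0 + s *\<^sub>R u"] by (simp flip: lift_mat_outer)
        also have "?sq (?e + s *\<^sub>R z) = ?sq ?e + s *\<^sub>R (outer ?e z + outer z ?e) + s\<^sup>2 *\<^sub>R ?sq z"
          by (simp add: vec_eq_iff algebra_simps power2_eq_square flip: lift_mat_outer)
        finally show ?thesis
          by (simp add: inner_add_right algebra_simps)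
      qed
      then have "0 \<le> Q \<bullet> ?sq z"
        by (rule leading_coefficient_nonneg)
      then show ?thesis
        using True by (simp add: z(1) E_sq inner_diff_left)
    next
      case False
      then have "(1 / t) *\<^sub>R u \<in> ?F"
        using pos z by blast
      then have "\<beta> < Q \<bullet> ?sq (vcat (vec 1) ((1 / t) *\<^sub>R u))"
        using sep(2) [OF G_lift_generator] by simp
      then have "t\<^sup>2 * \<beta> \<le> t\<^sup>2 * (Q \<bullet> ?sq (vcat (vec 1) ((1 / t) *\<^sub>R u)))"
        by (intro mult_left_mono) auto
      also have "\<dots> = Q \<bullet> ?sq z"
      proof -
        have "z = t *\<^sub>R vcat (vec 1) ((1 / t) *\<^sub>R u)"
          using False by (simp add: z(1) vcat_scaleR) (simp add: vec_eq_iff)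
        then have "?sq z = t\<^sup>2 *\<^sub>R ?sq (vcat (vec 1) ((1 / t) *\<^sub>R u))"
          by (metis outer_scaleR power2_eq_square)
        then show ?thesis
          by simp
      qed
      finally show ?thesis
        by (simp add: z(1) E_sq inner_diff_left mult.commute)
    qed
  qed
  then have "convex hull (?sq ` L) \<subseteq> {N. 0 \<le> (Q - \<beta> *\<^sub>R E) \<bullet> N}"
    by (intro hull_minimal) (simp_all add: convex_halfspace_ge)
  then show False
    using MconvL E sep(1) by (auto simp: inner_diff_left)
qed

text \<open>Principal submatrices, with rows and columns selected by \<open>\<sigma>\<close>.\<close>

lemma submatrix_in_CPP:
  fixes \<sigma> :: "'l::finite \<Rightarrow> 'k::finite"
  assumes "M \<in> CPP K" and "\<And>z. z \<in> K \<Longrightarrow> (\<chi> i. z $ \<sigma> i) \<in> L"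
  shows "(\<chi> i j. M $ \<sigma> i $ \<sigma> j) \<in> CPP L"
proof -
  let ?p = "\<lambda>M::real^'k^'k. \<chi> i j. M $ \<sigma> i $ \<sigma> j"
  have "linear ?p"
    by (rule linearI) (simp_all add: vec_eq_iff)
  then have "convex (?p -` CPP L)"
    by (intro convex_linear_vimage) (simp_all add: CPP_def)
  moreover have "outer z z \<in> ?p -` CPP L" if "z \<in> K" for z
  proof -
    have "?p (outer z z) = outer (\<chi> i. z $ \<sigma> i) (\<chi> i. z $ \<sigma> i)"
      by (simp add: vec_eq_iff)
    then show ?thesis
      using assms(2) [OF that] by (auto simp: CPP_def intro: hull_inc)
  qed
  ultimately have "CPP K \<subseteq> ?p -` CPP L"
    unfolding CPP_def [of K] by (intro hull_minimal) auto
  then show ?thesis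
    using assms(1) by auto
qed

lemma lift_mat_in_CPP:
  assumes "lift_mat3 x X y Y Z \<in> CPP (vprod J (vprod K L))"
  shows "lift_mat x X \<in> CPP (vprod J K)"
proof -
  let ?\<sigma> = "map_sum id Inl :: 1 + 'a \<Rightarrow> 1 + ('a + 'b)"
  have "(\<chi> i j. lift_mat3 x X y Y Z $ ?\<sigma> i $ ?\<sigma> j) \<in> CPP (vprod J K)"
  proof (rule submatrix_in_CPP [OF assms])
    fix z :: "real^(1 + ('a + 'b))"
    assume "z \<in> vprod J (vprod K L)"
    then obtain t u v where "z = vcat t (vcat u v)" "t \<in> J" "u \<in> K"
      unfolding vprod_def by blast
    moreover from this have "(\<chi> i. z $ ?\<sigma> i) = vcat t u"
      by (simp add: vec_eq_iff all_Plus_iff)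
    ultimately show "(\<chi> i. z $ ?\<sigma> i) \<in> vprod J K"
      unfolding vprod_def by auto
  qed
  moreover have "(\<chi> i j. lift_mat3 x X y Y Z $ ?\<sigma> i $ ?\<sigma> j) = lift_mat x X"
    by (simp add: vec_eq_iff all_Plus_iff lift_mat3_def lift_mat_def rowvector_def columnvector_def)
  ultimately show ?thesis
    by simp
qed


section \<open>Cones\<close>

text \<open>The two components of a concatenated vector.\<close>

definition vleft :: "real^('a::finite + 'b::finite) \<Rightarrow> real^'a" where
  "vleft z = (\<chi> i. z $ Inl i)"

definition vright :: "real^('a::finite + 'b::finite) \<Rightarrow> real^'b" where
  "vright z = (\<chi> j. z $ Inr j)"

lemma vleft_vcat [simp]: "vleft (vcat u v) = u"
  by (simp add: vleft_def vec_eq_iff)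

lemma vright_vcat [simp]: "vright (vcat u v) = v"
  by (simp add: vright_def vec_eq_iff)

lemma vcat_vleft_vright: "vcat (vleft z) (vright z) = z"
  by (simp add: vleft_def vright_def vec_eq_iff all_Plus_iff)

lemma linear_vleft: "linear vleft"
  by (rule linearI) (simp_all add: vleft_def vec_eq_iff)

lemma linear_vright: "linear vright"
  by (rule linearI) (simp_all add: vright_def vec_eq_iff)

lemma closed_linear_vimage:
  fixes p :: "'a::euclidean_space \<Rightarrow> 'b::real_normed_vector"
  assumes "linear p" "closed T"
  shows "closed (p -` T)"
  using assms linear_continuous_on [of p UNIV]
  by (intro closed_vimage) (simp_all add: linear_conv_bounded_linear)

lemma vprod_eq_vimage: "vprod K L = vleft -` K \<inter> vright -` L"
proof -
  have "z \<in> vprod K L" if "vleft z \<in> K" "vright z \<in> L" for z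
    using that vcat_vleft_vright [of z] unfolding vprod_def by (metis (mono_tags, lifting) CollectI)
  moreover have "z \<in> vleft -` K \<inter> vright -` L" if "z \<in> vprod K L" for z
    using that by (auto simp: vprod_def)
  ultimately show ?thesis
    by blast
qed

lemma closed_convex_cone_vprod:
  assumes "closed_convex_cone K" "closed_convex_cone L"
  shows "closed_convex_cone (vprod K L)"
  using assms
  by (auto simp: closed_convex_cone_def vprod_eq_vimage convex_cone_iff closed_linear_vimage
      linear_vleft linear_vright linear_add linear_scale linear_0 intro!: closed_Int)

lemma closed_convex_cone_slice:
  assumes "closed_convex_cone C"
  shows "closed {v \<in> C. h \<bullet> v = d}" and "convex {v \<in> C. h \<bullet> v = d}"
proof -
  have "{v \<in> C. h \<bullet> v = d} = C \<inter> {v. h \<bullet> v = d}"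
    by auto
  then show "closed {v \<in> C. h \<bullet> v = d}" "convex {v \<in> C. h \<bullet> v = d}"
    using assms
    by (simp_all add: closed_convex_cone_def convex_cone_def closed_Int closed_hyperplane
        convex_Int convex_hyperplane)
qed

lemma feas0_eq_slice: "feas0 K0 f d = {x \<in> K0. f \<bullet> x = d}"
  by (simp add: feas0_def)

lemma feas_eq_slice: "feas K0 K f g d = {v \<in> vprod K0 K. vcat f g \<bullet> v = d}"
  by (auto simp: feas_def vprod_def inner_vcat)

text \<open>Testing the ball around \<open>g\<close> in the direction \<open>- y\<close> bounds \<open>g \<bullet> y\<close> below by the norm on the cone.\<close>

lemma interior_dual_cone_coercive:
  assumes "g \<in> interior (dual_cone K)"
  obtains \<delta> where "0 < \<delta>" "\<And>y. y \<in> K \<Longrightarrow> \<delta> * norm y \<le> g \<bullet> y"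
proof -
  obtain e where e: "0 < e" "cball g e \<subseteq> dual_cone K"
    using assms by (auto simp: mem_interior_cball)
  have "e * norm y \<le> g \<bullet> y" if "y \<in> K" for y
  proof (cases "y = 0")
    case False
    have "g - (e / norm y) *\<^sub>R y \<in> cball g e"
      using e(1) False by (simp add: dist_norm)
    then have "g - (e / norm y) *\<^sub>R y \<in> dual_cone K"
      using e(2) by blast
    then have "0 \<le> y \<bullet> (g - (e / norm y) *\<^sub>R y)"
      using that unfolding dual_cone_def by blast
    also have "\<dots> = g \<bullet> y - e * norm y"
      using False by (simp add: inner_diff_right inner_commute dot_square_norm power2_eq_square)
    finally show ?thesis
      by simp
  qed simp
  then show ?thesis
    using that e(1) by blast
qed

text \<open>The point \<open>y\<^sub>0\<close> minimizes the form \<open>C\<close> over the slice \<open>g \<bullet> y = 1\<close> of the cone. If that slice is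
  empty, the cone is \<open>{0}\<close> and \<open>y\<^sub>0 = 0\<close>; the second conclusion says \<open>g \<bullet> y\<^sub>0 = 1\<close> unless \<open>g\<close> vanishes
  on the cone, and covers both cases.\<close>

lemma quadratic_minimizer_on_cone:
  fixes K :: "(real^'m) set"
  assumes K: "closed_convex_cone K" and g: "g \<in> interior (dual_cone K)"
  obtains y\<^sub>0 where "y\<^sub>0 \<in> K"
    and "\<And>y. y \<in> K \<Longrightarrow> (g \<bullet> y) * (g \<bullet> y\<^sub>0) = g \<bullet> y"
    and "\<And>y. y \<in> K \<Longrightarrow> (y\<^sub>0 \<bullet> (C *v y\<^sub>0)) * (g \<bullet> y)\<^sup>2 \<le> y \<bullet> (C *v y)"
proof -
  obtain \<delta> where \<delta>: "0 < \<delta>" "\<And>y. y \<in> K \<Longrightarrow> \<delta> * norm y \<le> g \<bullet> y"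
    using interior_dual_cone_coercive [OF g] by blast
  let ?T = "{y \<in> K. g \<bullet> y = 1}"
  have scaled: "(1 / (g \<bullet> y)) *\<^sub>R y \<in> ?T" if "y \<in> K" "y \<noteq> 0" for y
  proof -
    have "0 < \<delta> * norm y"
      using that \<delta>(1) by simp
    then have "0 < g \<bullet> y"
      using \<delta>(2) [OF that(1)] by linarith
    then show ?thesis
      using that(1) K by (simp add: closed_convex_cone_def convex_cone_scaleR)
  qed
  show thesis
  proof (cases "?T = {}")
    case True
    then have "y = 0" if "y \<in> K" for y
      using scaled that by blast
    moreover have "0 \<in> K"
      using K by (simp add: closed_convex_cone_def convex_cone_contains_0)
    ultimately show ?thesis
      using that [of 0] by fastforce
  next
    case False
    have "norm y \<le> 1 / \<delta>" if "y \<in> ?T" for y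
      using \<delta>(1) \<delta>(2) [of y] that by (simp add: field_simps)
    then have "bounded ?T"
      by (rule boundedI)
    then have "compact ?T"
      using closed_convex_cone_slice(1) [OF K] by (simp add: compact_eq_bounded_closed)
    moreover have "continuous_on ?T (\<lambda>y. y \<bullet> (C *v y))"
      by (intro continuous_intros linear_continuous_on matrix_vector_mul_bounded_linear)
    ultimately have "\<exists>x\<in>?T. \<forall>y\<in>?T. x \<bullet> (C *v x) \<le> y \<bullet> (C *v y)"
      using False by (intro continuous_attains_inf)
    then obtain y0 where y0: "y0 \<in> ?T" "\<And>y. y \<in> ?T \<Longrightarrow> y0 \<bullet> (C *v y0) \<le> y \<bullet> (C *v y)"
      by blast
    have "(y0 \<bullet> (C *v y0)) * (g \<bullet> y)\<^sup>2 \<le> y \<bullet> (C *v y)" if "y \<in> K" for y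
    proof (cases "y = 0")
      case False
      let ?z = "(1 / (g \<bullet> y)) *\<^sub>R y"
      have z: "?z \<in> ?T"
        by (rule scaled [OF that False])
      then have "g \<bullet> y \<noteq> 0"
        by auto
      then have y: "y = (g \<bullet> y) *\<^sub>R ?z"
        by simp
      have "(y0 \<bullet> (C *v y0)) * (g \<bullet> y)\<^sup>2 \<le> (?z \<bullet> (C *v ?z)) * (g \<bullet> y)\<^sup>2"
        by (intro mult_right_mono y0(2) z) simp
      also have "\<dots> = y \<bullet> (C *v y)"
        using \<open>g \<bullet> y \<noteq> 0\<close>
        by (simp add: matrix_vector_mult_scaleR power2_eq_square)
      finally show ?thesis .
    qed simp
    then show ?thesis
      using that [of y0] y0(1) by simp
  qed
qed


section \<open>The projected lifted sets are closed and convex\<close>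

lemma X0_set_eq_image: "X0_set K0 f d = (\<lambda>M. (wpart M, Wpart M)) ` G_lift (feas0 K0 f d)"
proof (intro equalityI subsetI)
  fix p
  assume "p \<in> X0_set K0 f d"
  then have "lift_mat (fst p) (snd p) \<in> G_lift (feas0 K0 f d)"
    by (auto simp: X0_set_def)
  then show "p \<in> (\<lambda>M. (wpart M, Wpart M)) ` G_lift (feas0 K0 f d)"
    by (rule rev_image_eqI) simp
qed (auto simp: X0_set_def simp flip: G_lift_eq_lift_mat)

lemma X0_set_closed_convex: "closed (X0_set K0 f d)" "convex (X0_set K0 f d)"
proof -
  have lin: "linear (\<lambda>M. (wpart M, Wpart M))"
    by (rule linearI) (simp_all add: wpart_def Wpart_def vec_eq_iff)
  show "convex (X0_set K0 f d)"
    unfolding X0_set_eq_image by (intro convex_linear_image lin convex_G_lift)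
  show "closed (X0_set K0 f d)"
    unfolding X0_set_eq_image
  proof (rule closed_image_of_controlled_norm [OF closed_G_lift lin])
    show "continuous_on UNIV (\<lambda>p. 1 + mat 1 \<bullet> snd p)"
      by (intro continuous_intros)
    show "norm M \<le> 1 + mat 1 \<bullet> snd (wpart M, Wpart M)" if "M \<in> G_lift (feas0 K0 f d)" for M
      using norm_G_lift_le that G_lift_eq_lift_mat [OF that] by (metis snd_conv)
  qed
qed

text \<open>The pair \<open>(x, X)\<close> of a matrix of the form \<open>lift_mat3 x X y Y Z\<close>.\<close>

definition xXpart :: "real^(1 + ('n::finite + 'm::finite))^(1 + ('n + 'm)) \<Rightarrow> (real^'n) \<times> (real^'n^'n)" where
  "xXpart M = (vleft (wpart M), \<chi> i j. Wpart M $ Inl i $ Inl j)"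

lemma xXpart_lift_mat3 [simp]: "xXpart (lift_mat3 x X y Y Z) = (x, X)"
  by (simp add: xXpart_def lift_mat3_def vec_eq_iff)

lemma linear_xXpart: "linear xXpart"
  by (rule linearI) (simp_all add: xXpart_def vleft_def wpart_def Wpart_def vec_eq_iff)

lemma Xi_set_eq_image: "Xi_set K0 K f g d = xXpart ` G_lift (feas K0 K f g d)"
proof (intro equalityI subsetI)
  fix p
  assume "p \<in> Xi_set K0 K f g d"
  then obtain y Y Z where "lift_mat3 (fst p) (snd p) y Y Z \<in> G_lift (feas K0 K f g d)"
    by (auto simp: Xi_set_def)
  then show "p \<in> xXpart ` G_lift (feas K0 K f g d)"
    by (rule rev_image_eqI) simp
next
  fix p
  assume "p \<in> xXpart ` G_lift (feas K0 K f g d)"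
  then obtain M where M: "M \<in> G_lift (feas K0 K f g d)" "p = xXpart M"
    by blast
  moreover obtain x X y Y Z where "M = lift_mat3 x X y Y Z"
    using G_lift_eq_lift_mat3 [OF M(1)] by blast
  ultimately show "p \<in> Xi_set K0 K f g d"
    by (auto simp: Xi_set_def)
qed

text \<open>The blocks that the projection drops are controlled by those it keeps: \<open>\<delta>\<^sup>2 \<bar>y\<bar>\<^sup>2 \<le> (d - f \<bullet> x)\<^sup>2\<close> on the
  feasible set, and this quadratic inequality lifts to a bound on the trace of \<open>Y\<close>.\<close>

lemma norm_lift_mat3_le:
  assumes mem: "lift_mat3 x X y Y Z \<in> G_lift (feas K0 K f g d)"
    and \<delta>: "0 < \<delta>" "\<And>y. y \<in> K \<Longrightarrow> \<delta> * norm y \<le> g \<bullet> y"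
  shows "norm (lift_mat3 x X y Y Z)
    \<le> 1 + mat 1 \<bullet> X + (d\<^sup>2 - 2 * d * (f \<bullet> x) + outer f f \<bullet> X) / \<delta>\<^sup>2"
proof -
  let ?s = "1 / \<delta>\<^sup>2"
  let ?h = "vcat ((- 2 * d * ?s) *\<^sub>R f) 0 :: real^('a + 'b)"
  let ?Q = "block_mat (?s *\<^sub>R outer f f) 0 0 (- mat 1) :: real^('a + 'b)^('a + 'b)"
  have "0 \<le> d\<^sup>2 * ?s + ?h \<bullet> v + v \<bullet> (?Q *v v)" if "v \<in> feas K0 K f g d" for v
  proof -
    obtain x' y' where v: "v = vcat x' y'" "y' \<in> K" "g \<bullet> y' = d - f \<bullet> x'"
      using \<open>v \<in> feas K0 K f g d\<close> unfolding feas_def by force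
    have "(\<delta> * norm y')\<^sup>2 \<le> (g \<bullet> y')\<^sup>2"
      using \<delta>(1) by (intro power_mono \<delta>(2) v(2)) simp
    then have "y' \<bullet> y' \<le> ?s * (d - f \<bullet> x')\<^sup>2"
      using \<delta>(1) by (simp add: v(3) power_mult_distrib power2_norm_eq_inner field_simps)
    also have "\<dots> = ?s * d\<^sup>2 - 2 * d * ?s * (f \<bullet> x') + ?s * (f \<bullet> x')\<^sup>2"
      by (simp add: power2_diff algebra_simps)
    finally show ?thesis
      by (simp add: v(1) inner_vcat inner_block_mat outer_vcat outer_inner_outer
          mat_1_inner_outer power2_eq_square flip: inner_outer)
  qed
  then have "0 \<le> d\<^sup>2 * ?s + ?h \<bullet> vcat x y + ?Q \<bullet> block_mat X (transpose Z) Z Y"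
    using mem unfolding lift_mat3_def by (rule quadratic_inequality_lifts [rotated])
  then have Y: "mat 1 \<bullet> Y \<le> (d\<^sup>2 - 2 * d * (f \<bullet> x) + outer f f \<bullet> X) / \<delta>\<^sup>2"
    by (simp add: inner_vcat inner_block_mat diff_divide_distrib add_divide_distrib)
  have "norm (lift_mat3 x X y Y Z) \<le> 1 + mat 1 \<bullet> block_mat X (transpose Z) Z Y"
    using mem unfolding lift_mat3_def by (rule norm_G_lift_le)
  also have "(mat 1 :: real^('a + 'b)^('a + 'b)) = block_mat (mat 1) 0 0 (mat 1)"
    by (auto simp: vec_eq_iff all_Plus_iff mat_def)
  also have "1 + \<dots> \<bullet> block_mat X (transpose Z) Z Y = 1 + mat 1 \<bullet> X + mat 1 \<bullet> Y"
    by (simp add: inner_block_mat)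
  finally show ?thesis
    using Y by simp
qed

lemma convex_Xi_set: "convex (Xi_set K0 K f g d)"
  unfolding Xi_set_eq_image by (intro convex_linear_image linear_xXpart convex_G_lift)

lemma closed_Xi_set:
  assumes "g \<in> interior (dual_cone K)"
  shows "closed (Xi_set K0 K f g d)"
proof -
  obtain \<delta> where \<delta>: "0 < \<delta>" "\<And>y. y \<in> K \<Longrightarrow> \<delta> * norm y \<le> g \<bullet> y"
    using interior_dual_cone_coercive [OF assms] by blast
  let ?b = "\<lambda>p. 1 + mat 1 \<bullet> snd p + (d\<^sup>2 - 2 * d * (f \<bullet> fst p) + outer f f \<bullet> snd p) / \<delta>\<^sup>2"
  show ?thesis
    unfolding Xi_set_eq_image
  proof (rule closed_image_of_controlled_norm [OF closed_G_lift linear_xXpart])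
    show "continuous_on UNIV ?b"
      using \<delta>(1) by (intro continuous_intros) simp
    fix M
    assume M: "M \<in> G_lift (feas K0 K f g d)"
    then obtain x X y Y Z where "M = lift_mat3 x X y Y Z"
      using G_lift_eq_lift_mat3 by blast
    then show "norm M \<le> ?b (xXpart M)"
      using norm_lift_mat3_le [OF _ \<delta>] M by simp
  qed
qed

lemma closed_convex_X_set:
  assumes "\<forall>i\<in>{1..S}. g i \<in> interior (dual_cone (K i))"
  shows "closed (X_set S K0 K f g d)" "convex (X_set S K0 K f g d)"
  using assms unfolding X_set_def
  by (auto intro!: closed_Int closed_INT convex_Int convex_INT X0_set_closed_convex closed_Xi_set
      convex_Xi_set)

lemma Xi_set_point_feasible:
  assumes K0: "closed_convex_cone K0" and K: "closed_convex_cone K"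
    and "(x, X) \<in> Xi_set K0 K f g d"
  obtains y where "y \<in> K" "f \<bullet> x + g \<bullet> y = d"
proof -
  obtain y Y Z where "lift_mat3 x X y Y Z \<in> G_lift (feas K0 K f g d)"
    using assms(3) by (auto simp: Xi_set_def)
  then have "wpart (lift_mat3 x X y Y Z) \<in> feas K0 K f g d"
    unfolding feas_eq_slice
    by (intro wpart_in_feasible_set closed_convex_cone_slice closed_convex_cone_vprod K0 K)
  then show thesis
    using that by (auto simp: lift_mat3_def feas_def)
qed

lemma X0_set_point_feasible:
  assumes "closed_convex_cone K0" "(x, X) \<in> X0_set K0 f d"
  shows "x \<in> K0" "f \<bullet> x = d"
proof -
  have "wpart (lift_mat x X) \<in> feas0 K0 f d"
    using assms unfolding feas0_eq_slice X0_set_def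
    by (intro wpart_in_feasible_set closed_convex_cone_slice) auto
  then show "x \<in> K0" "f \<bullet> x = d"
    by (simp_all add: feas0_def)
qed


section \<open>Feasible points of the conic problem\<close>

lemma cp_feasible_lift_mat3:
  assumes "closed_convex_cone K0" "closed_convex_cone (K i)" "i \<in> {1..S}"
    and "(X, x, Y, Z, y) \<in> cp_feasible S K0 K f g d"
  shows "lift_mat3 x X (y i) (Y i) (Z i) \<in> G_lift (feas K0 (K i) (f i) (g i) (d i))"
proof -
  have cone: "convex_cone (vprod K0 (K i))"
    using assms closed_convex_cone_vprod closed_convex_cone_def by blast
  have CPP: "lift_mat3 x X (y i) (Y i) (Z i) \<in> CPP (vprod nonneg_line (vprod K0 (K i)))"
    and lin: "f i \<bullet> x + g i \<bullet> y i = d i"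
    and quad: "outer (f i) (f i) \<bullet> X + 2 * (outer (g i) (f i) \<bullet> Z i) + outer (g i) (g i) \<bullet> Y i = (d i)\<^sup>2"
    using assms by (auto simp: cp_feasible_def mat_inner_eq_inner)
  have "outer (f i) (g i) \<bullet> transpose (Z i) = outer (g i) (f i) \<bullet> Z i"
    using inner_transpose [of "outer (g i) (f i)" "Z i"] by simp
  then show ?thesis
    using CPP lin quad unfolding feas_eq_slice lift_mat3_def
    by (intro CPP_imp_G_lift cone) (simp_all add: inner_vcat outer_vcat inner_block_mat)
qed

text \<open>The block \<open>[1, x\<^sup>T; x, X]\<close> is only constrained through the three-block matrices, which is why
  at least one of them is needed.\<close>

lemma cp_feasible_lift_mat:
  assumes "closed_convex_cone K0" "1 \<le> S"
    and "(X, x, Y, Z, y) \<in> cp_feasible S K0 K f g d"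
  shows "lift_mat x X \<in> G_lift (feas0 K0 (f 0) (d 0))"
proof -
  have "lift_mat3 x X (y 1) (Y 1) (Z 1) \<in> CPP (vprod nonneg_line (vprod K0 (K 1)))"
    using assms(2,3) unfolding cp_feasible_def by auto
  then have "lift_mat x X \<in> CPP (vprod nonneg_line K0)"
    by (rule lift_mat_in_CPP)
  then show ?thesis
    using assms(1,3) unfolding feas0_eq_slice cp_feasible_def closed_convex_cone_def
    by (intro CPP_imp_G_lift) (auto simp: mat_inner_eq_inner)
qed

lemma cp_feasible_in_X_set:
  assumes "closed_convex_cone K0" "\<forall>i\<in>{1..S}. closed_convex_cone (K i)" "1 \<le> S"
    and "(X, x, Y, Z, y) \<in> cp_feasible S K0 K f g d"
  shows "(x, X) \<in> X_set S K0 K f g d"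
  using cp_feasible_lift_mat [OF assms(1,3,4)] cp_feasible_lift_mat3 [OF assms(1) _ _ assms(4)]
    assms(2)
  unfolding X_set_def X0_set_def Xi_set_def by blast

lemma qp_feasible_imp_cp_feasible:
  assumes "(x, y) \<in> qp_feasible S K0 K f g d"
  shows "(outer x x, x, \<lambda>i. outer (y i) (y i), \<lambda>i. outer (y i) x, y) \<in> cp_feasible S K0 K f g d"
proof -
  have "lift_mat3 x (outer x x) (y i) (outer (y i) (y i)) (outer (y i) x)
      \<in> CPP (vprod nonneg_line (vprod K0 (K i)))" if "i \<in> {1..S}" for i
  proof -
    let ?z = "vcat (vec 1) (vcat x (y i)) :: real^(1 + ('a + 'b))"
    have "?z \<in> vprod nonneg_line (vprod K0 (K i))"
      using assms that unfolding vprod_def nonneg_line_def qp_feasible_def by force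
    then have "outer ?z ?z \<in> CPP (vprod nonneg_line (vprod K0 (K i)))"
      unfolding CPP_def by (intro hull_inc imageI)
    then show ?thesis
      by (simp add: lift_mat3_outer)
  qed
  moreover have "(f i \<bullet> x)\<^sup>2 + 2 * ((g i \<bullet> y i) * (f i \<bullet> x)) + (g i \<bullet> y i)\<^sup>2 = (d i)\<^sup>2"
    if "i \<in> {1..S}" for i
  proof -
    have "d i = f i \<bullet> x + g i \<bullet> y i"
      using assms that by (auto simp: qp_feasible_def)
    then show ?thesis
      by (simp add: power2_sum)
  qed
  ultimately show ?thesis
    using assms
    by (auto simp: cp_feasible_def qp_feasible_def sym_mats_def mat_inner_eq_inner
        outer_inner_outer power2_eq_square)
qed

lemma cp_objective_outer:
  "cp_objective S A a B C c (outer x x) x (\<lambda>i. outer (y i) (y i)) (\<lambda>i. outer (y i) x) y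
     = qp_objective S A a B C c x y"
proof -
  have "transpose (B i) \<bullet> outer (y i) x = x \<bullet> (B i *v y i)" for i
    using inner_transpose [of "B i" "outer x (y i)"] by (simp add: inner_outer)
  then show ?thesis
    by (simp add: cp_objective_def qp_objective_def mat_inner_eq_inner inner_outer)
qed

lemma cp_value_le_qp_value: "cp_value S K0 K A a B C c f g d \<le> qp_value S K0 K A a B C c f g d"
  unfolding qp_value_def
proof (rule INF_greatest, clarify)
  fix x y
  assume "(x, y) \<in> qp_feasible S K0 K f g d"
  from qp_feasible_imp_cp_feasible [OF this]
  show "cp_value S K0 K A a B C c f g d \<le> ereal (qp_objective S A a B C c x y)"
    unfolding cp_value_def by (rule INF_lower2) (simp add: cp_objective_outer)
qed


section \<open>Exactness\<close>

text \<open>On the feasible set \<open>g \<bullet> y = d - f \<bullet> x\<close>, hence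
  \<open>(b \<bullet> x)(g \<bullet> y) + y\<^sup>T C y + \<beta> (g \<bullet> y) \<ge> (d - f \<bullet> x)(b \<bullet> x) + q (d - f \<bullet> x)\<^sup>2 + \<beta> (d - f \<bullet> x)\<close>.
  The right side is quadratic in \<open>x\<close> only; lifting the inequality makes it affine in \<open>(x, X)\<close>.\<close>

lemma scenario_lower_bound:
  fixes K :: "(real^'m) set" and x :: "real^'n"
  assumes mem: "lift_mat3 x X y Y Z \<in> G_lift (feas K0 K f g d)"
    and q: "\<And>y. y \<in> K \<Longrightarrow> q * (g \<bullet> y)\<^sup>2 \<le> y \<bullet> (C *v y)"
  shows "(q * d\<^sup>2 + \<beta> * d) + (d *\<^sub>R b - (2 * q * d + \<beta>) *\<^sub>R f) \<bullet> x + (q *\<^sub>R outer f f - outer f b) \<bullet> X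
    \<le> outer g b \<bullet> Z + C \<bullet> Y + (\<beta> *\<^sub>R g) \<bullet> y"
proof -
  let ?\<alpha> = "- (q * d\<^sup>2 + \<beta> * d)"
  let ?h = "vcat ((2 * q * d + \<beta>) *\<^sub>R f - d *\<^sub>R b) (\<beta> *\<^sub>R g) :: real^('n + 'm)"
  let ?Q = "block_mat (outer f b - q *\<^sub>R outer f f) 0 (outer g b) C :: real^('n + 'm)^('n + 'm)"
  have "0 \<le> ?\<alpha> + ?h \<bullet> v + v \<bullet> (?Q *v v)" if "v \<in> feas K0 K f g d" for v
  proof -
    obtain x' y' where v: "v = vcat x' y'" "y' \<in> K" "g \<bullet> y' = d - f \<bullet> x'"
      using \<open>v \<in> feas K0 K f g d\<close> unfolding feas_def by force
    have "0 \<le> y' \<bullet> (C *v y') - q * (d - f \<bullet> x')\<^sup>2"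
      using q [OF v(2)] by (simp add: v(3))
    also have "\<dots> = ?\<alpha> + ?h \<bullet> v + ?Q \<bullet> outer v v"
      by (simp add: v(1) inner_vcat inner_block_mat outer_vcat outer_inner_outer inner_diff_left v(3))
        (simp add: inner_outer algebra_simps power2_eq_square)
    finally show ?thesis
      by (simp add: inner_outer)
  qed
  then have "0 \<le> ?\<alpha> + ?h \<bullet> vcat x y + ?Q \<bullet> block_mat X (transpose Z) Z Y"
    using mem unfolding lift_mat3_def by (rule quadratic_inequality_lifts [rotated])
  then show ?thesis
    by (simp add: inner_vcat inner_block_mat inner_diff_left)
qed

lemma extreme_point_below:
  fixes T :: "'a::euclidean_space set"
  assumes "compact T" "convex T" "p \<in> T"
  obtains e where "e extreme_point_of T" "h \<bullet> e \<le> h \<bullet> p"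
proof (rule ccontr)
  assume "\<not> thesis"
  then have "{e. e extreme_point_of T} \<subseteq> {e. h \<bullet> e > h \<bullet> p}"
    using that by force
  then have "convex hull {e. e extreme_point_of T} \<subseteq> {e. h \<bullet> e > h \<bullet> p}"
    by (intro hull_minimal convex_halfspace_gt)
  then show False
    using Krein_Milman_Minkowski [OF assms(1,2)] assms(3) by auto
qed

lemma qp_value_le_cp_value:
  fixes K0 :: "(real^'n) set" and K :: "nat \<Rightarrow> (real^'m) set"
  assumes S: "1 \<le> S" and K0: "closed_convex_cone K0"
    and K: "\<forall>i\<in>{1..S}. closed_convex_cone (K i)"
    and cB: "\<forall>i\<in>{1..S}. c i = \<beta> i *\<^sub>R g i \<and> B i = outer (b i) (g i)"
    and g: "\<forall>i\<in>{1..S}. g i \<in> interior (dual_cone (K i))"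
    and bdd: "bounded (X_set S K0 K f g d)"
    and extr: "\<forall>p. p extreme_point_of X_set S K0 K f g d \<longrightarrow> (\<exists>x. p = (x, outer x x))"
  shows "qp_value S K0 K A a B C c f g d \<le> cp_value S K0 K A a B C c f g d"
  unfolding cp_value_def
proof (rule INF_greatest)
  fix p
  assume p: "p \<in> cp_feasible S K0 K f g d"
  obtain X x Y Z y where p_eq: "p = (X, x, Y, Z, y)"
    by (rule prod_cases5)
  have feasible: "(X, x, Y, Z, y) \<in> cp_feasible S K0 K f g d"
    using p by (simp only: p_eq)
  have "\<forall>i. \<exists>y0. i \<in> {1..S} \<longrightarrow> y0 \<in> K i \<and> (\<forall>y\<in>K i. (g i \<bullet> y) * (g i \<bullet> y0) = g i \<bullet> y \<and>
      (y0 \<bullet> (C i *v y0)) * (g i \<bullet> y)\<^sup>2 \<le> y \<bullet> (C i *v y))"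
    using quadratic_minimizer_on_cone K g by metis
  then obtain y0 where y0: "\<And>i. i \<in> {1..S} \<Longrightarrow> y0 i \<in> K i"
    "\<And>i y. i \<in> {1..S} \<Longrightarrow> y \<in> K i \<Longrightarrow> (g i \<bullet> y) * (g i \<bullet> y0 i) = g i \<bullet> y"
    "\<And>i y. i \<in> {1..S} \<Longrightarrow> y \<in> K i \<Longrightarrow> (y0 i \<bullet> (C i *v y0 i)) * (g i \<bullet> y)\<^sup>2 \<le> y \<bullet> (C i *v y)"
    by metis
  \<comment> \<open>\<open>k i + u i \<bullet> x + U i \<bullet> X\<close> is the affine bound on the \<open>i\<close>-th summand.\<close>
  define q where "q i = y0 i \<bullet> (C i *v y0 i)" for i
  define k where "k i = q i * (d i)\<^sup>2 + \<beta> i * d i" for i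
  define u where "u i = d i *\<^sub>R b i - (2 * q i * d i + \<beta> i) *\<^sub>R f i" for i
  define U where "U i = q i *\<^sub>R outer (f i) (f i) - outer (f i) (b i)" for i
  let ?h = "(a + (\<Sum>i=1..S. u i), A + (\<Sum>i=1..S. U i))"
  have h: "(\<Sum>i=1..S. k i) + ?h \<bullet> (x', X')
      = A \<bullet> X' + a \<bullet> x' + (\<Sum>i=1..S. k i + u i \<bullet> x' + U i \<bullet> X')" for x' X'
    by (simp add: inner_add_left inner_sum_left sum.distrib)
  have lower: "(\<Sum>i=1..S. k i) + ?h \<bullet> (x, X) \<le> cp_objective S A a B C c X x Y Z y"
    unfolding h cp_objective_def mat_inner_eq_inner
  proof (intro add_left_mono sum_mono)
    fix i
    assume i: "i \<in> {1..S}"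
    show "k i + u i \<bullet> x + U i \<bullet> X \<le> transpose (B i) \<bullet> Z i + C i \<bullet> Y i + c i \<bullet> y i"
      using scenario_lower_bound [OF cp_feasible_lift_mat3 [OF K0 _ i feasible],
          of "q i" "C i" "\<beta> i" "b i"] K cB i y0(3)
      by (simp add: k_def u_def U_def q_def)
  qed
  have "compact (X_set S K0 K f g d)"
    using bdd closed_convex_X_set [OF g] by (simp add: compact_eq_bounded_closed)
  then obtain e where e: "e extreme_point_of X_set S K0 K f g d" "?h \<bullet> e \<le> ?h \<bullet> (x, X)"
    using extreme_point_below closed_convex_X_set(2) [OF g]
      cp_feasible_in_X_set [OF K0 K S feasible] by blast
  then obtain \<xi> where \<xi>: "e = (\<xi>, outer \<xi> \<xi>)"
    using extr by blast
  have mem: "(\<xi>, outer \<xi> \<xi>) \<in> X_set S K0 K f g d"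
    using e(1) \<xi> by (simp add: extreme_point_of_def)
  \<comment> \<open>The scaling turns \<open>y0 i\<close> into an optimal choice of \<open>y\<^sub>i\<close> for the given \<open>\<xi>\<close>.\<close>
  define \<eta> where "\<eta> i = (d i - f i \<bullet> \<xi>) *\<^sub>R y0 i" for i
  have \<eta>: "\<eta> i \<in> K i" "g i \<bullet> \<eta> i = d i - f i \<bullet> \<xi>" if i: "i \<in> {1..S}" for i
  proof -
    have "(\<xi>, outer \<xi> \<xi>) \<in> Xi_set K0 (K i) (f i) (g i) (d i)"
      using mem i unfolding X_set_def by blast
    then obtain y' where y': "y' \<in> K i" "f i \<bullet> \<xi> + g i \<bullet> y' = d i"
      using Xi_set_point_feasible K0 K i by blast
    have gy': "g i \<bullet> y' = d i - f i \<bullet> \<xi>"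
      using y'(2) by simp
    have "g i \<in> dual_cone (K i)"
      using g i interior_subset by blast
    then have "0 \<le> d i - f i \<bullet> \<xi>"
      using y'(1) gy' by (auto simp: dual_cone_def inner_commute)
    then show "\<eta> i \<in> K i"
      using K y0(1) i by (simp add: \<eta>_def closed_convex_cone_def convex_cone_scaleR)
    show "g i \<bullet> \<eta> i = d i - f i \<bullet> \<xi>"
      using y0(2) [OF i y'(1)] by (simp add: \<eta>_def gy')
  qed
  have "(\<xi>, \<eta>) \<in> qp_feasible S K0 K f g d"
    using X0_set_point_feasible [OF K0, of \<xi> "outer \<xi> \<xi>" "f 0" "d 0"] mem \<eta>
    by (auto simp: qp_feasible_def X_set_def)
  then have "qp_value S K0 K A a B C c f g d \<le> ereal (qp_objective S A a B C c \<xi> \<eta>)"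
    unfolding qp_value_def by (rule INF_lower2) simp
  also have "qp_objective S A a B C c \<xi> \<eta> = (\<Sum>i=1..S. k i) + ?h \<bullet> e"
  proof -
    have "\<xi> \<bullet> (B i *v \<eta> i) + \<eta> i \<bullet> (C i *v \<eta> i) + c i \<bullet> \<eta> i
        = k i + u i \<bullet> \<xi> + U i \<bullet> outer \<xi> \<xi>" if i: "i \<in> {1..S}" for i
    proof -
      have quad: "\<eta> i \<bullet> (C i *v \<eta> i) = (d i - f i \<bullet> \<xi>)\<^sup>2 * q i"
        by (simp add: \<eta>_def q_def matrix_vector_mult_scaleR power2_eq_square)
      have "\<xi> \<bullet> (B i *v \<eta> i) + \<eta> i \<bullet> (C i *v \<eta> i) + c i \<bullet> \<eta> i
          = (d i - f i \<bullet> \<xi>) * (b i \<bullet> \<xi>) + (d i - f i \<bullet> \<xi>)\<^sup>2 * q i + \<beta> i * (d i - f i \<bullet> \<xi>)"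
        using cB i unfolding quad
        by (simp add: outer_mult_vec \<eta>(2) [OF i] inner_commute [of \<xi> "b i"])
      also have "\<dots> = k i + u i \<bullet> \<xi> + U i \<bullet> outer \<xi> \<xi>"
        by (simp add: k_def u_def U_def inner_diff_left outer_inner_outer)
          (simp add: algebra_simps power2_eq_square)
      finally show ?thesis .
    qed
    then have "(\<Sum>i=1..S. \<xi> \<bullet> (B i *v \<eta> i) + \<eta> i \<bullet> (C i *v \<eta> i) + c i \<bullet> \<eta> i)
        = (\<Sum>i=1..S. k i + u i \<bullet> \<xi> + U i \<bullet> outer \<xi> \<xi>)"
      by (rule sum.cong [OF refl])
    then show ?thesis
      unfolding \<xi> h qp_objective_def inner_outer [of A] by (simp only:)
  qed
  also have "\<dots> \<le> cp_objective S A a B C c X x Y Z y"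
    using e(2) lower by linarith
  finally show "qp_value S K0 K A a B C c f g d
      \<le> (case p of (X, x, Y, Z, y) \<Rightarrow> ereal (cp_objective S A a B C c X x Y Z y))"
    by (simp add: p_eq)
qed

theorem theorem9:
  fixes S :: nat
    and K0 :: "(real^'n) set" and K :: "nat \<Rightarrow> (real^'m) set"
    and A :: "real^'n^'n" and a :: "real^'n"
    and B :: "nat \<Rightarrow> real^'m^'n" and C :: "nat \<Rightarrow> real^'m^'m"
    and c g :: "nat \<Rightarrow> real^'m" and f :: "nat \<Rightarrow> real^'n" and d :: "nat \<Rightarrow> real"
  assumes "S \<ge> 1"
    and "closed_convex_cone K0"
    and "\<forall>i\<in>{1..S}. closed_convex_cone (K i)"
    and "A \<in> sym_mats"
    and "\<forall>i\<in>{1..S}. C i \<in> sym_mats"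
  shows "cp_value S K0 K A a B C c f g d \<le> qp_value S K0 K A a B C c f g d
    \<and> ((\<exists>(b :: nat \<Rightarrow> real^'n) (\<beta> :: nat \<Rightarrow> real).
           \<forall>i\<in>{1..S}. c i = \<beta> i *\<^sub>R g i \<and> B i = outer (b i) (g i))
       \<and> (\<forall>i\<in>{1..S}. g i \<in> interior (dual_cone (K i)))
       \<and> bounded (X_set S K0 K f g d)
       \<and> (\<forall>p. p extreme_point_of X_set S K0 K f g d \<longrightarrow> (\<exists>x. p = (x, outer x x)))
       \<longrightarrow> cp_value S K0 K A a B C c f g d = qp_value S K0 K A a B C c f g d)"
proof (intro conjI impI cp_value_le_qp_value, elim conjE exE)
  fix b \<beta>
  assume "\<forall>i\<in>{1..S}. c i = \<beta> i *\<^sub>R g i \<and> B i = outer (b i) (g i)"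
    and "\<forall>i\<in>{1..S}. g i \<in> interior (dual_cone (K i))"
    and "bounded (X_set S K0 K f g d)"
    and "\<forall>p. p extreme_point_of X_set S K0 K f g d \<longrightarrow> (\<exists>x. p = (x, outer x x))"
  then show "cp_value S K0 K A a B C c f g d = qp_value S K0 K A a B C c f g d"
    by (intro antisym cp_value_le_qp_value qp_value_le_cp_value [OF assms(1-3)])
qed

end
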